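(* Let \(n\) be a nonnegative integer, let \(A\) and \(B\) be subsets of \(\{0,1,\ldots,n\}\) of equal size, and let \(A^\mathsf{c}\) and \(B^\mathsf{c}\) be their complements in \(\{0,1,\ldots,n\}\). Let \(\alpha\) and \(\beta\) be partitions with \(n\) parts (with parts equal to \(0\) permitted) such that \(\alpha_i \leq \beta_i\) for all \(i \in [n]\). Suppose each part of \(\alpha\) and \(\beta\) is at most \(1\) less than the preceding part. Then the determinants \[ \det\Bigl( h_{b - a} (x_{\alpha_{a+1}+1}, x_{\alpha_{a+1}+2}, \ldots, x_{\beta_{b}}) \Bigr)_{a \in A, b \in B} \] and \[ \det\Bigl( e_{a' - b'} (x_{\alpha_{a'}+1}, x_{\alpha_{a'}+2}, \ldots, x_{\beta_{b'+1}}) \Bigr)_{a' \in A^\mathsf{c}, b' \in B^\mathsf{c}} \] are equal.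
   Context: Here \(h_i\) and \(e_i\) denote the complete homogeneous and elementary symmetric polynomials of degree \(i\), with the conventions \(e_0 = h_0 = 1\) and \(e_d = h_d = 0\) for \(d < 0\); symmetric polynomials of positive degree in an empty set of variables are \(0\). Finite subsets of \(\mathbb{Z}\) used to index matrix rows and columns are ordered from smallest to largest element. Where needed, \(\alpha_{n+1}\) is interpreted as \(\alpha_n\) and \(\beta_0\) as \(\beta_1\). *)

theory Defs
  imports
    "HOL-Library.Multiset"
    "HOL-Library.Poly_Mapping"
    "Jordan_Normal_Form.Determinant"
begin

text \<open>
  Polynomials over \<open>'a\<close> in indeterminates indexed by the natural numbers, as finitely
  supported maps from monomials (themselves finitely supported exponent vectors) to coefficients.
\<close>

type_synonym 'a mvpoly = "(nat \<Rightarrow>\<^sub>0 nat) \<Rightarrow>\<^sub>0 'a"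

definition indet :: "nat \<Rightarrow> 'a::comm_ring_1 mvpoly" where
  "indet i = Poly_Mapping.single (Poly_Mapping.single i 1) 1"

text \<open>
  Symmetric polynomials in the indeterminates with index in a finite set \<open>S\<close>: sums over the
  multisets, respectively the subsets, of \<open>S\<close> of size \<open>d\<close>. The degree is an integer; for
  \<open>d < 0\<close> both sums are empty. In particular both polynomials are \<open>0\<close> in negative degree,
  \<open>1\<close> in degree \<open>0\<close>, and \<open>0\<close> in positive degree when \<open>S\<close> is empty.
\<close>

definition complete_sym :: "int \<Rightarrow> nat set \<Rightarrow> 'a::comm_ring_1 mvpoly" where
  "complete_sym d S = (\<Sum>M | set_mset M \<subseteq> S \<and> int (size M) = d. \<Prod>i\<in>#M. indet i)"

definition elementary_sym :: "int \<Rightarrow> nat set \<Rightarrow> 'a::comm_ring_1 mvpoly" where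
  "elementary_sym d S = (\<Sum>T | T \<subseteq> S \<and> int (card T) = d. \<Prod>i\<in>T. indet i)"

lemma complete_sym_conventions:
  "d < 0 \<Longrightarrow> complete_sym d S = 0"
  "complete_sym 0 S = 1"
  "d > 0 \<Longrightarrow> complete_sym d {} = 0"
proof -
  have "{M. set_mset M \<subseteq> S \<and> int (size M) = d} = {}" if "d < 0"
    using that by auto
  then show "complete_sym d S = 0" if "d < 0"
    using that by (simp only: complete_sym_def sum.empty)
  have "{M. set_mset M \<subseteq> S \<and> int (size M) = 0} = {{#}}"
    by auto
  then show "complete_sym 0 S = 1"
    by (simp add: complete_sym_def)
  have "{M. set_mset M \<subseteq> ({} :: nat set) \<and> int (size M) = d} = {}" if "d > 0"
    using that by auto
  then show "complete_sym d {} = 0" if "d > 0"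
    using that by (simp only: complete_sym_def sum.empty)
qed

lemma elementary_sym_conventions:
  "d < 0 \<Longrightarrow> elementary_sym d S = 0"
  "finite S \<Longrightarrow> elementary_sym 0 S = 1"
  "d > 0 \<Longrightarrow> elementary_sym d {} = 0"
proof -
  have "{T. T \<subseteq> S \<and> int (card T) = d} = {}" if "d < 0"
    using that by auto
  then show "elementary_sym d S = 0" if "d < 0"
    using that by (simp only: elementary_sym_def sum.empty)
  have "{T. T \<subseteq> S \<and> int (card T) = 0} = {{}}" if "finite S"
    using that by (auto dest: finite_subset)
  then show "elementary_sym 0 S = 1" if "finite S"
    using that by (simp add: elementary_sym_def)
  have "{T. T \<subseteq> ({} :: nat set) \<and> int (card T) = d} = {}" if "d > 0"
    using that by auto
  then show "elementary_sym d {} = 0" if "d > 0"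
    using that by (simp only: elementary_sym_def sum.empty)
qed

text \<open>A partition with exactly \<open>n\<close> parts, parts equal to \<open>0\<close> being permitted.\<close>

definition is_partition :: "nat \<Rightarrow> nat list \<Rightarrow> bool" where
  "is_partition n \<alpha> \<longleftrightarrow> length \<alpha> = n \<and> sorted_wrt (\<ge>) \<alpha>"

text \<open>
  The \<open>i\<close>-th part, counted from \<open>1\<close>. Out-of-range indices are clamped to \<open>1..n\<close>, so the
  part of index \<open>n + 1\<close> is the one of index \<open>n\<close> and the part of index \<open>0\<close> is the one of
  index \<open>1\<close>. The value \<open>0\<close> chosen for the empty list has no influence: when \<open>n = 0\<close> only
  symmetric polynomials of degree \<open>0\<close> occur.
\<close>

definition part :: "nat list \<Rightarrow> nat \<Rightarrow> nat" where
  "part \<alpha> i = (if \<alpha> = [] then 0 else \<alpha> ! (max 1 (min i (length \<alpha>)) - 1))"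

text \<open>Matrices with rows and columns indexed by finite sets of naturals in increasing order.\<close>

definition indexed_mat :: "nat set \<Rightarrow> nat set \<Rightarrow> (nat \<Rightarrow> nat \<Rightarrow> 'b) \<Rightarrow> 'b mat" where
  "indexed_mat A B f =
     Matrix.mat (card A) (card B)
       (\<lambda>(i, j). f (sorted_list_of_set A ! i) (sorted_list_of_set B ! j))"

end

theory Submission
  imports Defs "HOL-Computational_Algebra.Formal_Power_Series"
begin

text \<open>
  The matrix of complete symmetric polynomials is unitriangular, and its inverse is the transposed
  matrix of elementary ones with checkerboard signs; the two determinants are then complementary
  minors in Jacobi's theorem. For the inverse, write \<open>B\<^sub>c = (\<Prod>i\<le>\<beta>\<^sub>c. 1 - x\<^sub>i t)\<close>. The entry \<open>(a, b)\<close>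
  of the product, \<open>a < b\<close>, is
  \<open>\<Sum>c. [t\<^bsup>c-a\<^esup>](U / B\<^sub>c) * [t\<^bsup>b-c\<^esup>](B\<^bsub>c+1\<^esub> * V)\<close> with \<open>U = (\<Prod>i\<le>\<alpha>\<^bsub>a+1\<^esub>. 1 - x\<^sub>i t)\<close> and
  \<open>V = 1 / (\<Prod>i\<le>\<alpha>\<^sub>b. 1 - x\<^sub>i t)\<close>. As \<open>B\<^sub>c / B\<^bsub>c+1\<^esub>\<close> is \<open>1\<close> or a single linear factor, the sum
  telescopes to \<open>[t\<^bsup>b-a\<^esup>](U * V)\<close>, which vanishes since \<open>U * V\<close> is a polynomial of degree
  \<open>\<alpha>\<^bsub>a+1\<^esub> - \<alpha>\<^sub>b < b - a\<close>.
\<close>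

section \<open>Complementary minors\<close>

lemma det_unit_row:
  fixes M :: "'a::comm_ring_1 mat"
  assumes "M \<in> carrier_mat n n" and "r < n" and "c < n"
    and "\<And>j. j < n \<Longrightarrow> M $$ (r, j) = (if j = c then 1 else 0)"
  shows "det M = (-1) ^ (r + c) * det (mat_delete M r c)"
proof -
  have "det M = (\<Sum>j<n. M $$ (r, j) * cofactor M r j)"
    using assms by (intro laplace_expansion_row)
  also have "\<dots> = (\<Sum>j<n. if j = c then cofactor M r j else 0)"
    using assms by (intro sum.cong) auto
  finally show ?thesis
    using assms by (simp add: cofactor_def)
qed

lemma det_unit_col:
  fixes M :: "'a::comm_ring_1 mat"
  assumes "M \<in> carrier_mat n n" and "r < n" and "c < n"
    and "\<And>i. i < n \<Longrightarrow> M $$ (i, c) = (if i = r then 1 else 0)"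
  shows "det M = (-1) ^ (r + c) * det (mat_delete M r c)"
proof -
  have "det M = (\<Sum>i<n. M $$ (i, c) * cofactor M i c)"
    using assms by (intro laplace_expansion_column)
  also have "\<dots> = (\<Sum>i<n. if i = r then cofactor M i c else 0)"
    using assms by (intro sum.cong) auto
  finally show ?thesis
    using assms by (simp add: cofactor_def)
qed

text \<open>Laplace expansion along the last unit column deletes the last row and column. Both have
  the same index, so the sign is positive, and \<open>q\<close> such steps strip the identity
  columns.\<close>

lemma det_last_cols_unit:
  fixes f :: "nat \<times> nat \<Rightarrow> 'a::comm_ring_1"
  assumes "\<And>i j. i < p + q \<Longrightarrow> p \<le> j \<Longrightarrow> j < p + q \<Longrightarrow> f (i, j) = (if i = j then 1 else 0)"
  shows "det (Matrix.mat (p + q) (p + q) f) = det (Matrix.mat p p f)"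
  using assms
proof (induction q)
  case (Suc q)
  let ?M = "Matrix.mat (p + Suc q) (p + Suc q) f"
  have "det ?M = (-1) ^ ((p + q) + (p + q)) * det (mat_delete ?M (p + q) (p + q))"
    by (rule det_unit_col[where n = "p + Suc q"]) (use Suc.prems in auto)
  also have "mat_delete ?M (p + q) (p + q) = Matrix.mat (p + q) (p + q) f"
    by (rule eq_matI) (auto simp: mat_delete_def)
  finally show ?case
    using Suc by (simp flip: mult_2)
qed simp

lemma det_first_cols_unit:
  fixes f :: "nat \<times> nat \<Rightarrow> 'a::comm_ring_1"
  assumes "\<And>i j. i < p + q \<Longrightarrow> j < p \<Longrightarrow> f (i, j) = (if i = j then 1 else 0)"
  shows "det (Matrix.mat (p + q) (p + q) f) = det (Matrix.mat q q (\<lambda>(i, j). f (p + i, p + j)))"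
  using assms
proof (induction p arbitrary: f)
  case 0
  then show ?case by (simp add: case_prod_beta)
next
  case (Suc p)
  let ?M = "Matrix.mat (Suc p + q) (Suc p + q) f"
  have "det ?M = (-1) ^ (0 + 0) * det (mat_delete ?M 0 0)"
    by (rule det_unit_col[where n = "Suc p + q"]) (use Suc.prems in auto)
  also have "mat_delete ?M 0 0 = Matrix.mat (p + q) (p + q) (\<lambda>(i, j). f (Suc i, Suc j))"
    by (rule eq_matI) (auto simp: mat_delete_def)
  also have "det \<dots> = det (Matrix.mat q q (\<lambda>(i, j). f (Suc p + i, Suc p + j)))"
    by (subst Suc.IH) (use Suc.prems in auto)
  finally show ?case by simp
qed

section \<open>Permutations that move a chosen index set to the front\<close>

definition shuffle_list :: "nat \<Rightarrow> nat set \<Rightarrow> nat list" where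
  "shuffle_list N A = sorted_list_of_set A @ sorted_list_of_set ({..<N} - A)"

text \<open>This is the permutation matrix of the Grassmannian permutation with one-line notation
  \<open>shuffle_list N A\<close>. Multiplying by it on the left, and by such a transpose on the
  right, brings a minor into the leading corner.\<close>

definition shuffle_mat :: "nat \<Rightarrow> nat set \<Rightarrow> 'a::comm_ring_1 mat" where
  "shuffle_mat N A = Matrix.mat N N (\<lambda>(i, j). if shuffle_list N A ! i = j then 1 else 0)"

lemma shuffle_list_facts:
  assumes "A \<subseteq> {..<N}"
  shows "length (shuffle_list N A) = N" and "distinct (shuffle_list N A)"
    and "set (shuffle_list N A) = {..<N}"
proof -
  have fin: "finite A" using assms finite_subset by blast
  then show "distinct (shuffle_list N A)" and "set (shuffle_list N A) = {..<N}"
    using assms by (auto simp: shuffle_list_def)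
  then show "length (shuffle_list N A) = N"
    by (metis card_lessThan distinct_card)
qed

lemma shuffle_list_bij:
  assumes "A \<subseteq> {..<N}"
  shows "bij_betw ((!) (shuffle_list N A)) {..<N} {..<N}"
  using shuffle_list_facts[OF assms] by (intro bij_betw_nth) auto

lemma shuffle_list_less:
  assumes "A \<subseteq> {..<N}" and "i < N"
  shows "shuffle_list N A ! i < N"
  using shuffle_list_bij[OF assms(1)] assms(2) by (auto dest: bij_betwE)

lemma shuffle_list_left:
  assumes "i < card A"
  shows "shuffle_list N A ! i = sorted_list_of_set A ! i"
  using assms by (simp add: shuffle_list_def nth_append)

lemma shuffle_list_right:
  "shuffle_list N A ! (card A + i) = sorted_list_of_set ({..<N} - A) ! i"
  by (simp add: shuffle_list_def nth_append)

lemma sorted_list_of_set_insert_top: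
  fixes N :: nat
  assumes "A \<subseteq> {..<N}"
  shows "sorted_list_of_set (insert N A) = sorted_list_of_set A @ [N]"
proof -
  have fin: "finite A" using assms finite_subset by blast
  have "sorted (sorted_list_of_set A @ [N])" "distinct (sorted_list_of_set A @ [N])"
    "set (sorted_list_of_set A @ [N]) = insert N A"
    using assms fin by (auto simp: sorted_append less_imp_le)
  then show ?thesis
    by (metis sorted_list_of_set.idem_if_sorted_distinct)
qed

text \<open>The Grassmannian permutation of \<open>A\<close> has
  \<open>\<Sum>A - \<Sum>{..<card A}\<close> inversions; the sum in the exponent has the same parity
  and avoids subtraction on naturals. The induction removes the largest index.\<close>

lemma det_shuffle_mat:
  assumes "A \<subseteq> {..<N}"
  shows "det (shuffle_mat N A :: 'a::comm_ring_1 mat) = (-1) ^ (\<Sum>A + \<Sum>{..<card A})"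
  using assms
proof (induction N arbitrary: A)
  case 0
  then show ?case by (simp add: shuffle_mat_def)
next
  case (Suc N)
  let ?M = "shuffle_mat (Suc N) A :: 'a mat"
  show ?case
  proof (cases "N \<in> A")
    case False
    then have A: "A \<subseteq> {..<N}"
      using Suc.prems by (auto simp: less_Suc_eq)
    have "{..<Suc N} - A = insert N ({..<N} - A)"
      using False by auto
    then have list: "shuffle_list (Suc N) A = shuffle_list N A @ [N]"
      by (simp only: shuffle_list_def sorted_list_of_set_insert_top[OF Diff_subset] append_assoc)
    note len = shuffle_list_facts(1)[OF A]
    have "det ?M = (-1) ^ (N + N) * det (mat_delete ?M N N)"
      by (rule det_unit_row[where n = "Suc N"])
        (auto simp: shuffle_mat_def list nth_append len)
    also have "mat_delete ?M N N = shuffle_mat N A"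
      by (rule eq_matI) (auto simp: mat_delete_def shuffle_mat_def list nth_append len)
    finally show ?thesis
      using Suc.IH[OF A] by (simp flip: mult_2)
  next
    case True
    define A' where "A' = A - {N}"
    have A: "A = insert N A'" "A' \<subseteq> {..<N}" "N \<notin> A'"
      using True Suc.prems by (auto simp: A'_def less_Suc_eq)
    have fin: "finite A'" using A(2) finite_subset by blast
    let ?k = "card A'"
    have "?k \<le> N" using card_mono[OF _ A(2)] by simp
    have "{..<Suc N} - A = {..<N} - A'"
      using A by auto
    then have list: "shuffle_list (Suc N) A =
        sorted_list_of_set A' @ [N] @ sorted_list_of_set ({..<N} - A')"
      using A by (simp add: shuffle_list_def sorted_list_of_set_insert_top)
    \<comment> \<open>The exponent matches the growth of the claimed one: \<open>N\<close> is the
      new summand of \<open>\<Sum>A\<close>, and \<open>?k\<close> that of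
      \<open>\<Sum>{..<card A}\<close>.\<close>
    have "det ?M = (-1) ^ (?k + N) * det (mat_delete ?M ?k N)"
      by (rule det_unit_row[where n = "Suc N"])
        (use \<open>?k \<le> N\<close> in \<open>auto simp: shuffle_mat_def list nth_append\<close>)
    also have "mat_delete ?M ?k N = shuffle_mat N A'"
      by (rule eq_matI)
        (auto simp: mat_delete_def shuffle_mat_def list nth_append shuffle_list_def[of N A'] Suc_diff_le)
    finally show ?thesis
      using Suc.IH[OF A(2)] A fin by (simp add: power_add mult_ac)
  qed
qed

lemma shuffle_rows_cols:
  fixes f :: "nat \<Rightarrow> nat \<Rightarrow> 'a::comm_ring_1"
  assumes A: "A \<subseteq> {..<N}" and B: "B \<subseteq> {..<N}"
  shows "Matrix.mat N N (\<lambda>(i, j). f (shuffle_list N A ! i) (shuffle_list N B ! j)) =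
    shuffle_mat N A * Matrix.mat N N (\<lambda>(i, j). f i j) * (shuffle_mat N B)\<^sup>T"
proof -
  have 1: "shuffle_mat N A * Matrix.mat N N (\<lambda>(i, j). f i j) =
      Matrix.mat N N (\<lambda>(i, j). f (shuffle_list N A ! i) j)"
    using shuffle_list_less[OF A]
    by (intro eq_matI) (auto simp: shuffle_mat_def scalar_prod_def sum.delta' if_distrib[of "\<lambda>x. x * _"] cong: if_cong)
  show ?thesis
    unfolding 1 using shuffle_list_less[OF B]
    by (intro eq_matI) (auto simp: shuffle_mat_def scalar_prod_def sum.delta' if_distrib[of "\<lambda>x. _ * x"] cong: if_cong)
qed

lemma det_shuffle_rows_cols:
  fixes f :: "nat \<Rightarrow> nat \<Rightarrow> 'a::comm_ring_1"
  assumes A: "A \<subseteq> {..<N}" and B: "B \<subseteq> {..<N}" and "card A = card B"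
  shows "det (Matrix.mat N N (\<lambda>(i, j). f (shuffle_list N A ! i) (shuffle_list N B ! j))) =
    (-1) ^ (\<Sum>A + \<Sum>B) * det (Matrix.mat N N (\<lambda>(i, j). f i j))"
proof -
  have carr: "shuffle_mat N C \<in> carrier_mat N N" for C
    by (simp add: shuffle_mat_def)
  \<comment> \<open>Since \<open>card A = card B\<close>, both permutation signs contain this
    factor, and it cancels.\<close>
  have "(-1) ^ (\<Sum>{..<card B}) * (-1) ^ (\<Sum>{..<card B}) = (1 :: 'a)"
    by (simp flip: power_add mult_2)
  then have "det (shuffle_mat N A) * det (shuffle_mat N B) = ((-1) ^ (\<Sum>A + \<Sum>B) :: 'a)"
    using assms by (simp add: det_shuffle_mat power_add mult_ac)
  moreover have "det (Matrix.mat N N (\<lambda>(i, j). f (shuffle_list N A ! i) (shuffle_list N B ! j))) =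
      det (shuffle_mat N A) * det (Matrix.mat N N (\<lambda>(i, j). f i j)) * det (shuffle_mat N B)"
    unfolding shuffle_rows_cols[OF A B]
    by (simp add: det_mult[of _ N] det_transpose[OF carr] carr mult_carrier_mat[of _ N N])
  ultimately show ?thesis
    by (metis mult.assoc mult.commute)
qed

text \<open>Jacobi's identity by exchanging columns: each minor is the determinant of a reordered
  matrix some of whose columns are replaced by unit columns, and multiplication by the reordered
  \<open>f\<close> turns one such matrix into the other.\<close>

lemma jacobi_complementary_minor:
  fixes f g :: "nat \<Rightarrow> nat \<Rightarrow> 'a::comm_ring_1"
  assumes A: "A \<subseteq> {..<N}" and B: "B \<subseteq> {..<N}" and card: "card A = card B"
    and inv: "\<And>a b. a < N \<Longrightarrow> b < N \<Longrightarrow> (\<Sum>c<N. f a c * g c b) = (if a = b then 1 else 0)"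
  shows "det (indexed_mat A B f) = (-1) ^ (\<Sum>A + \<Sum>B) * det (Matrix.mat N N (\<lambda>(i, j). f i j)) *
    det (indexed_mat ({..<N} - B) ({..<N} - A) g)"
proof -
  let ?x = "(!) (shuffle_list N A)" and ?y = "(!) (shuffle_list N B)" and ?k = "card A"
  have fin: "finite A" "finite B" using A B finite_subset by blast+
  have "?k \<le> N" using card_mono[OF _ A] by simp
  then obtain q where N: "N = ?k + q" using le_Suc_ex by blast
  have cardc: "card ({..<N} - A) = q" "card ({..<N} - B) = q"
    using A B fin card N by (simp_all add: card_Diff_subset)
  define F where "F = Matrix.mat N N (\<lambda>(i, j). f (?x i) (?y j))"
  \<comment> \<open>Multiplication by \<open>F\<close> sends the unit columns of \<open>w\<close> to
    the first \<open>?k\<close> columns of \<open>F\<close>, and the columns taken from the inverse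
    \<open>g\<close> to unit columns; the result is \<open>v\<close>.\<close>
  define v where "v = (\<lambda>(i, j). if j < ?k then f (?x i) (?y j) else if i = j then 1 else 0)"
  define w where "w = (\<lambda>(i, j). if j < ?k then if i = j then 1 else 0 else g (?y i) (?x j))"
  have prod: "(\<Sum>l<N. f (?x i) (?y l) * g (?y l) (?x j)) = (if i = j then 1 else 0)"
    if "i < N" "j < N" for i j
  proof -
    have "(\<Sum>l<N. f (?x i) (?y l) * g (?y l) (?x j)) = (\<Sum>c<N. f (?x i) c * g c (?x j))"
      by (rule sum.reindex_bij_betw[OF shuffle_list_bij[OF B], of "\<lambda>c. f (?x i) c * g c (?x j)"])
    also have "\<dots> = (if ?x i = ?x j then 1 else 0)"
      using that by (intro inv shuffle_list_less A)
    also have "?x i = ?x j \<longleftrightarrow> i = j"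
      using that shuffle_list_facts[OF A] by (simp add: nth_eq_iff_index_eq)
    finally show ?thesis .
  qed
  have "F * Matrix.mat N N w = Matrix.mat N N v"
  proof (rule eq_matI)
    fix i j assume "i < dim_row (Matrix.mat N N v)" "j < dim_col (Matrix.mat N N v)"
    then have ij: "i < N" "j < N" by auto
    then show "(F * Matrix.mat N N w) $$ (i, j) = Matrix.mat N N v $$ (i, j)"
      using prod[OF ij]
      by (cases "j < ?k")
        (simp_all add: F_def v_def w_def scalar_prod_def lessThan_atLeast0 sum.delta'
          if_distrib[of "\<lambda>x. _ * x"] cong: if_cong)
  qed (simp_all add: F_def)
  then have "det (Matrix.mat N N v) = det F * det (Matrix.mat N N w)"
    by (metis F_def det_mult mat_carrier)
  moreover have "det (Matrix.mat N N v) = det (Matrix.mat ?k ?k v)"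
    unfolding N by (rule det_last_cols_unit) (auto simp: v_def)
  moreover have "Matrix.mat ?k ?k v = indexed_mat A B f"
    unfolding indexed_mat_def card[symmetric]
    by (rule eq_matI) (use card in \<open>auto simp: v_def shuffle_list_left\<close>)
  \<comment> \<open>The surviving block has rows from the complement of \<open>B\<close> and columns
    from that of \<open>A\<close>: an inverse exchanges the roles of the two orderings.\<close>
  moreover have "det (Matrix.mat N N w) = det (Matrix.mat q q (\<lambda>(i, j). w (?k + i, ?k + j)))"
    unfolding N by (rule det_first_cols_unit) (auto simp: w_def)
  moreover have "Matrix.mat q q (\<lambda>(i, j). w (?k + i, ?k + j)) =
      indexed_mat ({..<N} - B) ({..<N} - A) g"
    unfolding indexed_mat_def cardc
    by (rule eq_matI) (auto simp: w_def shuffle_list_right, simp add: card shuffle_list_right)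
  ultimately show ?thesis
    using det_shuffle_rows_cols[OF A B card, of f] by (simp add: F_def)
qed

section \<open>Transposing and rescaling indexed matrices\<close>

lemma det_indexed_mat_transpose:
  fixes f :: "nat \<Rightarrow> nat \<Rightarrow> 'a::comm_ring_1"
  assumes "card A = card B"
  shows "det (indexed_mat A B f) = det (indexed_mat B A (\<lambda>b a. f a b))"
proof -
  have "indexed_mat B A (\<lambda>b a. f a b) = (indexed_mat A B f)\<^sup>T"
    by (rule eq_matI) (auto simp: indexed_mat_def)
  moreover have "indexed_mat A B f \<in> carrier_mat (card A) (card A)"
    using assms by (simp add: indexed_mat_def)
  ultimately show ?thesis by (simp add: det_transpose)
qed

lemma prod_sorted_list_of_set:
  assumes "finite A"
  shows "(\<Prod>i<card A. h (sorted_list_of_set A ! i)) = prod h A"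
proof -
  have "bij_betw ((!) (sorted_list_of_set A)) {..<card A} A"
    using assms by (intro bij_betw_nth) auto
  then show ?thesis by (rule prod.reindex_bij_betw)
qed

text \<open>In the Leibniz expansion each permutation picks one entry per row and per column, so
  every summand carries each row factor and each column factor exactly once.\<close>

lemma det_indexed_mat_scale:
  fixes f :: "nat \<Rightarrow> nat \<Rightarrow> 'a::comm_ring_1"
  assumes "card A = card B" and "finite A" and "finite B"
  shows "det (indexed_mat A B (\<lambda>a b. s a * t b * f a b)) =
    prod s A * prod t B * det (indexed_mat A B f)"
proof -
  let ?k = "card A" and ?x = "(!) (sorted_list_of_set A)" and ?y = "(!) (sorted_list_of_set B)"
  have carr: "indexed_mat A B h \<in> carrier_mat ?k ?k" for h :: "nat \<Rightarrow> nat \<Rightarrow> 'a"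
    using assms by (simp add: indexed_mat_def)
  have "(\<Prod>i = 0..<?k. indexed_mat A B (\<lambda>a b. s a * t b * f a b) $$ (i, p i)) =
      prod s A * prod t B * (\<Prod>i = 0..<?k. indexed_mat A B f $$ (i, p i))"
    if p: "p permutes {0..<?k}" for p
  proof -
    have lt: "p i < ?k" if "i < ?k" for i
      using permutes_in_image[OF p, of i] that by simp
    have "(\<Prod>i = 0..<?k. t (?y (p i))) = (\<Prod>i = 0..<?k. t (?y i))"
      using prod.permute[OF p, of "\<lambda>i. t (?y i)"] by (simp add: o_def)
    then have "prod t B = (\<Prod>i = 0..<?k. t (?y (p i)))"
      using prod_sorted_list_of_set[OF assms(3), of t] assms(1) by (simp add: lessThan_atLeast0)
    moreover have "prod s A = (\<Prod>i = 0..<?k. s (?x i))"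
      using prod_sorted_list_of_set[OF assms(2), of s] by (simp add: lessThan_atLeast0)
    moreover have "(\<Prod>i = 0..<?k. indexed_mat A B (\<lambda>a b. s a * t b * f a b) $$ (i, p i)) =
        (\<Prod>i = 0..<?k. s (?x i) * t (?y (p i)) * indexed_mat A B f $$ (i, p i))"
      using lt assms(1) by (intro prod.cong) (auto simp: indexed_mat_def)
    ultimately show ?thesis by (simp add: prod.distrib)
  qed
  then show ?thesis
    by (simp add: det_def'[OF carr] sum_distrib_left mult_ac)
qed

section \<open>Generating functions\<close>

no_notation vec_index (infixl "$" 100)
unbundle fps_syntax

section \<open>Recursions in the set of variables\<close>

lemma finite_multisets_of_size:
  assumes "finite S"
  shows "finite {M. set_mset M \<subseteq> S \<and> int (size M) = d}"
proof -
  have "{M. set_mset M \<subseteq> S \<and> int (size M) = d} \<subseteq>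
      mset ` {xs. set xs \<subseteq> S \<and> length xs = nat d}"
  proof
    fix M assume M: "M \<in> {M. set_mset M \<subseteq> S \<and> int (size M) = d}"
    obtain xs where "M = mset xs" using ex_mset by metis
    with M show "M \<in> mset ` {xs. set xs \<subseteq> S \<and> length xs = nat d}" by auto
  qed
  then show ?thesis
    using finite_lists_length_eq[OF assms] finite_subset by blast
qed

text \<open>A multiset either avoids \<open>x\<close> or loses one copy of it; the remainder may
  still contain \<open>x\<close>, which is why the second term keeps
  \<open>insert x S\<close>.\<close>

lemma complete_sym_insert:
  assumes "finite S" and "x \<notin> S"
  shows "complete_sym d (insert x S) =
    complete_sym d S + indet x * complete_sym (d - 1) (insert x S)"
proof -
  let ?U = "{M. set_mset M \<subseteq> insert x S \<and> int (size M) = d}"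
  let ?V = "{M. set_mset M \<subseteq> S \<and> int (size M) = d}"
  let ?W = "{M. set_mset M \<subseteq> insert x S \<and> int (size M) = d - 1}"
  let ?p = "\<lambda>M. \<Prod>i\<in>#M. indet i"
  have fin: "finite ?V" "finite ?W"
    using assms(1) by (simp_all add: finite_multisets_of_size)
  have U: "?U = ?V \<union> add_mset x ` ?W"
  proof (intro equalityI subsetI)
    fix M assume M: "M \<in> ?U"
    show "M \<in> ?V \<union> add_mset x ` ?W"
    proof (cases "x \<in># M")
      case True
      then obtain M' where "M = add_mset x M'" by (metis insert_DiffM)
      with M show ?thesis by auto
    next
      case False
      then have "set_mset M \<subseteq> S"
        using M by blast
      then show ?thesis using M by blast
    qed
  next
    fix M assume "M \<in> ?V \<union> add_mset x ` ?W"
    then consider "M \<in> ?V" | M' where "M' \<in> ?W" "M = add_mset x M'" by blast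
    then show "M \<in> ?U"
      by cases auto
  qed
  have "x \<notin># M" if "M \<in> ?V" for M
    using that assms(2) by blast
  moreover have "x \<in># M" if "M \<in> add_mset x ` ?W" for M
    using that by (elim imageE) simp
  ultimately have disj: "?V \<inter> add_mset x ` ?W = {}"
    by blast
  have "sum ?p ?U = sum ?p ?V + sum ?p (add_mset x ` ?W)"
    unfolding U using fin disj by (intro sum.union_disjoint finite_imageI)
  also have "sum ?p (add_mset x ` ?W) = (\<Sum>M\<in>?W. indet x * ?p M)"
    by (subst sum.reindex) (auto simp: inj_on_def)
  finally show ?thesis
    by (simp only: complete_sym_def sum_distrib_left)
qed

text \<open>Unlike with multisets, removing \<open>x\<close> from a set leaves a subset of
  \<open>S\<close>.\<close>

lemma elementary_sym_insert:
  assumes "finite S" and "x \<notin> S"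
  shows "elementary_sym d (insert x S) =
    elementary_sym d S + indet x * elementary_sym (d - 1) S"
proof -
  let ?U = "{T. T \<subseteq> insert x S \<and> int (card T) = d}"
  let ?V = "{T. T \<subseteq> S \<and> int (card T) = d}"
  let ?W = "{T. T \<subseteq> S \<and> int (card T) = d - 1}"
  let ?p = "\<lambda>T. \<Prod>i\<in>T. indet i"
  have fin: "finite ?V" "finite ?W"
    using assms(1) by simp_all
  have xT: "finite T \<and> x \<notin> T" if "T \<in> ?W" for T
    using that assms finite_subset by blast
  have U: "?U = ?V \<union> insert x ` ?W"
  proof (intro equalityI subsetI)
    fix T assume T: "T \<in> ?U"
    show "T \<in> ?V \<union> insert x ` ?W"
    proof (cases "x \<in> T")
      case True
      have "finite T" using T assms(1) finite_subset by blast
      then have "card T = Suc (card (T - {x}))"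
        using True by (rule card.remove)
      then have "T - {x} \<in> ?W" using T by auto
      moreover have "T = insert x (T - {x})" using True by auto
      ultimately show ?thesis by blast
    next
      case False
      then have "T \<subseteq> S"
        using T by blast
      then show ?thesis using T by blast
    qed
  next
    fix T assume "T \<in> ?V \<union> insert x ` ?W"
    then consider "T \<in> ?V" | T' where "T' \<in> ?W" "T = insert x T'" by blast
    then show "T \<in> ?U"
    proof cases
      case 2
      then have "int (card T) = d" using xT[of T'] by simp
      then show ?thesis using 2 by blast
    qed blast
  qed
  have disj: "?V \<inter> insert x ` ?W = {}"
    using assms(2) by blast
  have inj: "inj_on (insert x) ?W"
    using xT by (intro inj_onI) (metis insert_ident)
  have "sum ?p ?U = sum ?p ?V + sum ?p (insert x ` ?W)"
    unfolding U using fin disj by (intro sum.union_disjoint finite_imageI)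
  also have "sum ?p (insert x ` ?W) = (\<Sum>T\<in>?W. indet x * ?p T)"
    unfolding sum.reindex[OF inj] o_def
    by (rule sum.cong[OF refl]) (use xT in \<open>simp only: prod.insert not_False_eq_True\<close>)
  finally show ?thesis
    by (simp only: elementary_sym_def sum_distrib_left)
qed

section \<open>Products of linear factors and of their inverses\<close>

definition lin_fps :: "nat \<Rightarrow> 'a::comm_ring_1 mvpoly fps" where
  "lin_fps i = 1 - fps_const (indet i) * fps_X"

text \<open>This is the inverse of \<open>lin_fps i\<close>, given by its coefficients because the
  coefficient ring is not a field.\<close>

definition geom_fps :: "nat \<Rightarrow> 'a::comm_ring_1 mvpoly fps" where
  "geom_fps i = Abs_fps (\<lambda>k. indet i ^ k)"

lemma linear_factor_mult_nth:
  "((1 - fps_const y * fps_X) * F) $ k =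
    (F :: 'a::comm_ring_1 fps) $ k - y * (if k = 0 then 0 else F $ (k - 1))"
  by (simp add: left_diff_distrib mult.assoc)

lemmas lin_mult_nth = linear_factor_mult_nth[of "indet i" for i, folded lin_fps_def]

lemma lin_geom: "lin_fps i * geom_fps i = 1"
proof (rule fps_ext)
  fix k show "(lin_fps i * geom_fps i) $ k = (1 :: 'a mvpoly fps) $ k"
    by (cases k) (simp_all add: lin_mult_nth geom_fps_def del: fps_mult_nth_0)
qed

lemma prod_lin_geom: "prod lin_fps S * prod geom_fps S = 1"
  by (simp add: lin_geom flip: prod.distrib)

lemma complete_sym_nth:
  assumes "finite S"
  shows "prod geom_fps S $ k = complete_sym (int k) S"
  using assms
proof (induction S arbitrary: k rule: finite_induct)
  case empty
  then show ?case
    by (cases "k = 0") (simp_all add: complete_sym_conventions)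
next
  case (insert x S)
  \<comment> \<open>Cancelling the new factor shows that the coefficients obey the recursion of
    \<open>complete_sym_insert\<close>.\<close>
  have "lin_fps x * prod geom_fps (insert x S) = prod geom_fps S"
    using insert by (simp add: lin_geom flip: mult.assoc)
  then have step: "prod geom_fps (insert x S) $ k = prod geom_fps S $ k +
      indet x * (if k = 0 then 0 else prod geom_fps (insert x S) $ (k - 1))" for k
    using lin_mult_nth[of x "prod geom_fps (insert x S)" k] by (metis diff_add_cancel)
  \<comment> \<open>That recursion lowers the degree while keeping \<open>insert x S\<close>, hence
    an inner induction on the degree.\<close>
  show ?case
  proof (induction k)
    case 0
    show ?case
      by (subst step) (simp add: insert.IH complete_sym_conventions)
  next
    case (Suc k)
    show ?case
      by (subst step) (use insert Suc in \<open>simp add: complete_sym_insert[of S x "1 + int k"]\<close>)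
  qed
qed

lemma elementary_sym_nth:
  assumes "finite S"
  shows "prod lin_fps S $ k = (-1) ^ k * elementary_sym (int k) S"
  using assms
proof (induction S arbitrary: k rule: finite_induct)
  case empty
  then show ?case
    by (cases "k = 0") (simp_all add: elementary_sym_conventions)
next
  case (insert x S)
  then show ?case
    by (cases k)
      (simp_all add: lin_mult_nth elementary_sym_conventions elementary_sym_insert algebra_simps
        del: fps_mult_nth_0)
qed

lemma elementary_sym_eq_0:
  assumes "finite S" and "d > int (card S)"
  shows "elementary_sym d S = 0"
proof -
  have "int (card T) \<noteq> d" if "T \<subseteq> S" for T
    using card_mono[OF assms(1) that] assms(2) by simp
  then have "{T. T \<subseteq> S \<and> int (card T) = d} = {}"
    by blast
  then show ?thesis by (simp only: elementary_sym_def sum.empty)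
qed

text \<open>The product is a polynomial of degree at most \<open>card S\<close>; both vanishing
  coefficients in the orthogonality proof come from this bound.\<close>

lemma prod_lin_nth_eq_0:
  assumes "finite S" and "card S < k"
  shows "prod lin_fps S $ k = 0"
  using assms by (simp add: elementary_sym_nth elementary_sym_eq_0)

lemma prod_atLeast1_split:
  fixes p q :: nat
  assumes "p \<le> q"
  shows "prod h {1..q} = prod h {1..p} * prod h {p + 1..q}"
  using prod.ub_add_nat[of 1 p h "q - p"] assms by simp

text \<open>The common factors cancel. Which range is longer decides whether the quotient generates
  complete polynomials, as here, or signed elementary ones, as in
  \<open>lin_geom_ge\<close>.\<close>

lemma lin_geom_le:
  assumes "p \<le> q"
  shows "prod lin_fps {1..p} * prod geom_fps {1..q} = prod geom_fps {p + 1..q}"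
proof -
  have "prod lin_fps {1..p} * prod geom_fps {1..q} =
      (prod lin_fps {1..p} * prod geom_fps {1..p}) * prod geom_fps {p + 1..q}"
    unfolding prod_atLeast1_split[OF assms] by (simp only: mult.assoc)
  then show ?thesis by (simp add: prod_lin_geom)
qed

lemma lin_geom_ge:
  assumes "p \<le> q"
  shows "prod lin_fps {1..q} * prod geom_fps {1..p} = prod lin_fps {p + 1..q}"
proof -
  have "prod lin_fps {1..q} * prod geom_fps {1..p} =
      prod lin_fps {p + 1..q} * (prod lin_fps {1..p} * prod geom_fps {1..p})"
    unfolding prod_atLeast1_split[OF assms] by (simp only: mult_ac)
  then show ?thesis by (simp add: prod_lin_geom)
qed

text \<open>Constant terms are the same for all sets, so entries of degree 0 come out right even for
  empty ranges or a part index outside \<open>1..n\<close>.\<close>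

lemma lin_geom_nth_0: "(prod lin_fps S * prod geom_fps T) $ 0 = 1"
proof -
  have "prod lin_fps S $ 0 = (1 :: 'a mvpoly)" for S
    by (induction S rule: infinite_finite_induct) (simp_all add: lin_fps_def)
  moreover have "prod geom_fps S $ 0 = (1 :: 'a mvpoly)" for S
    by (induction S rule: infinite_finite_induct) (simp_all add: geom_fps_def)
  ultimately show ?thesis by simp
qed

section \<open>Telescoping convolutions\<close>

text \<open>Summation by parts: a full convolution lets a linear factor pass freely from
  \<open>Q\<close> to \<open>P\<close>; cutting it off below \<open>k\<close> leaves one boundary
  term.\<close>

lemma conv_tail_shift:
  fixes P Q :: "'a::comm_ring_1 fps"
  assumes "k \<le> m"
  shows "(\<Sum>c=k..m. P $ c * ((1 - fps_const y * fps_X) * Q) $ (m - c)) =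
    P $ k * Q $ (m - k) + (\<Sum>c=Suc k..m. ((1 - fps_const y * fps_X) * P) $ c * Q $ (m - c))"
proof -
  have "(\<Sum>c=k..m. P $ c * (if m - c = 0 then 0 else Q $ (m - c - 1))) =
      (\<Sum>c=k..<m. P $ c * Q $ (m - c - 1))"
    by (rule sum.mono_neutral_cong_right) auto
  also have "\<dots> = (\<Sum>c=Suc k..m. P $ (c - 1) * Q $ (m - c))"
    by (rule sum.reindex_bij_witness[of _ "\<lambda>c. c - 1" Suc]) auto
  finally have shift: "(\<Sum>c=k..m. P $ c * (if m - c = 0 then 0 else Q $ (m - c - 1))) =
      (\<Sum>c=Suc k..m. P $ (c - 1) * Q $ (m - c))" .
  have "(\<Sum>c=k..m. P $ c * ((1 - fps_const y * fps_X) * Q) $ (m - c)) =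
      (\<Sum>c=k..m. P $ c * Q $ (m - c)) -
      y * (\<Sum>c=k..m. P $ c * (if m - c = 0 then 0 else Q $ (m - c - 1)))"
    unfolding linear_factor_mult_nth
    by (simp only: right_diff_distrib sum_subtractf sum_distrib_left mult_ac)
  moreover have "(\<Sum>c=k..m. P $ c * Q $ (m - c)) =
      P $ k * Q $ (m - k) + (\<Sum>c=Suc k..m. P $ c * Q $ (m - c))"
    using assms by (rule sum.atLeast_Suc_atMost)
  moreover have "(\<Sum>c=Suc k..m. ((1 - fps_const y * fps_X) * P) $ c * Q $ (m - c)) =
      (\<Sum>c=Suc k..m. P $ c * Q $ (m - c)) - y * (\<Sum>c=Suc k..m. P $ (c - 1) * Q $ (m - c))"
    unfolding linear_factor_mult_nth
    by (simp add: algebra_simps sum_subtractf sum_distrib_left)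
  ultimately show ?thesis
    unfolding shift by simp
qed

text \<open>The linear relations are assumed only for \<open>1 \<le> j < m\<close>. At both ends
  just a constant coefficient changes its index, which \<open>P0\<close> and \<open>Qm\<close>
  cover.\<close>

lemma telescoping_conv:
  fixes P Q :: "nat \<Rightarrow> 'a::comm_ring_1 fps"
  assumes "1 \<le> m"
    and step: "\<And>j. 1 \<le> j \<Longrightarrow> j < m \<Longrightarrow> \<exists>y. P (Suc j) = (1 - fps_const y * fps_X) * P j \<and>
        Q j = (1 - fps_const y * fps_X) * Q (Suc j)"
    and P0: "P 0 $ 0 = P 1 $ 0" and Qm: "Q (Suc m) $ 0 = Q m $ 0"
  shows "(\<Sum>j\<le>m. P j $ j * Q (Suc j) $ (m - j)) = (P 1 * Q 1) $ m"
proof -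
  \<comment> \<open>Invariant: the first \<open>k\<close> terms are final, and the rest is still the
    tail of the convolution of \<open>P k\<close> and \<open>Q k\<close>. Each step splits off the
    boundary term of \<open>conv_tail_shift\<close>.\<close>
  have "(\<Sum>j<k. P j $ j * Q (Suc j) $ (m - j)) + (\<Sum>c=k..m. P k $ c * Q k $ (m - c)) =
      (P 1 * Q 1) $ m" if "1 \<le> k" "k \<le> m" for k
    using that
  proof (induction k rule: dec_induct)
    case base
    have "(P 1 * Q 1) $ m = P 1 $ 0 * Q 1 $ m + (\<Sum>c=Suc 0..m. P 1 $ c * Q 1 $ (m - c))"
      by (simp add: fps_mult_nth sum.atLeast_Suc_atMost)
    then show ?case using P0 by simp
  next
    case (step k)
    then obtain y where y: "P (Suc k) = (1 - fps_const y * fps_X) * P k"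
        "Q k = (1 - fps_const y * fps_X) * Q (Suc k)"
      using assms(2)[of k] by auto
    show ?case
      using step conv_tail_shift[of k m "P k" y "Q (Suc k)"]
      by (simp add: add.assoc flip: y)
  qed
  from this[OF assms(1) order_refl] show ?thesis
    using Qm by (simp add: lessThan_Suc_atMost[symmetric])
qed

section \<open>Slowly decreasing partitions and orthogonality\<close>

lemma part_mono:
  assumes "is_partition n \<alpha>" and "1 \<le> i" and "i \<le> j" and "j \<le> n"
  shows "part \<alpha> j \<le> part \<alpha> i"
proof -
  have "\<alpha> ! (j - 1) \<le> \<alpha> ! (i - 1)" if "i \<noteq> j"
    using assms that by (auto simp: is_partition_def intro: sorted_wrt_nth_less)
  then show ?thesis
    using assms by (cases "i = j") (auto simp: part_def is_partition_def)
qed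

lemma part_descent:
  assumes "\<forall>i\<in>{1..<n}. int (part \<alpha> (i + 1)) \<ge> int (part \<alpha> i) - 1"
    and "1 \<le> i" and "i \<le> j" and "j \<le> n"
  shows "part \<alpha> i \<le> part \<alpha> j + (j - i)"
  using assms(3,4)
proof (induction j rule: dec_induct)
  case (step j)
  then have "int (part \<alpha> (j + 1)) \<ge> int (part \<alpha> j) - 1"
    using assms(1,2) by auto
  then show ?case using step by (simp add: Suc_diff_le)
qed simp

text \<open>The sum is an entry above the diagonal of the product of the two matrices, with
  summation index \<open>c = a + j\<close>.\<close>

lemma complete_elementary_orthogonal:
  assumes \<alpha>: "is_partition n \<alpha>" and \<beta>: "is_partition n \<beta>"
    and le: "\<forall>i\<in>{1..n}. part \<alpha> i \<le> part \<beta> i"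
    and d\<alpha>: "\<forall>i\<in>{1..<n}. int (part \<alpha> (i + 1)) \<ge> int (part \<alpha> i) - 1"
    and d\<beta>: "\<forall>i\<in>{1..<n}. int (part \<beta> (i + 1)) \<ge> int (part \<beta> i) - 1"
    and "a < b" and "b \<le> n"
  shows "(\<Sum>j\<le>b - a. complete_sym (int j) {part \<alpha> (a + 1) + 1..part \<beta> (a + j)} *
    ((-1) ^ (b - a - j) *
      elementary_sym (int (b - a - j)) {part \<alpha> b + 1..part \<beta> (a + j + 1)})) =
    (0 :: 'a::comm_ring_1 mvpoly)"
proof -
  define m where "m = b - a"
  define p where "p = part \<alpha> (a + 1)"
  define r where "r = part \<alpha> b"
  \<comment> \<open>\<open>P j\<close> and \<open>Q j\<close> are \<open>U / B\<^sub>c\<close> and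
    \<open>B\<^sub>c * V\<close> for \<open>c = a + j\<close>; the product \<open>P j * Q j\<close>
    does not depend on \<open>j\<close>.\<close>
  define P :: "nat \<Rightarrow> 'a mvpoly fps"
    where "P j = prod lin_fps {1..p} * prod geom_fps {1..part \<beta> (a + j)}" for j
  define Q :: "nat \<Rightarrow> 'a mvpoly fps"
    where "Q j = prod lin_fps {1..part \<beta> (a + j)} * prod geom_fps {1..r}" for j
  have m: "1 \<le> m" "b = a + m" using assms by (auto simp: m_def)
  \<comment> \<open>Only \<open>m - 1\<close> steps lead from index \<open>a + 1\<close> to
    \<open>b\<close>, so \<alpha> drops by less than \<open>m\<close>.\<close>
  have rp: "r \<le> p" "p - r < m"
    using part_mono[OF \<alpha>, of "a + 1" b] part_descent[OF d\<alpha>, of "a + 1" b] assms m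
    by (auto simp: p_def r_def)
  have h: "complete_sym (int j) {p + 1..part \<beta> (a + j)} = P j $ j" if "j \<le> m" for j
  proof (cases "p \<le> part \<beta> (a + j)")
    case True
    then show ?thesis
      unfolding P_def lin_geom_le[OF True] by (intro complete_sym_nth[symmetric]) simp
  next
    case False
    show ?thesis
    proof (cases "j = 0")
      case True
      then show ?thesis
        by (simp only: P_def lin_geom_nth_0 complete_sym_conventions of_nat_0)
    next
      case j: False
      \<comment> \<open>The variable range is empty, but \<open>P j\<close> is now a polynomial. Its
        degree is below \<open>j\<close>, because \<beta> starts at \<open>p\<close> or above and
        loses at most \<open>j - 1\<close> up to index \<open>a + j\<close>.\<close>
      have "p \<le> part \<beta> (a + 1)" using le assms by (auto simp: p_def)
      also have "\<dots> \<le> part \<beta> (a + j) + (j - 1)"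
        using part_descent[OF d\<beta>, of "a + 1" "a + j"] that j m assms by auto
      finally have "p - part \<beta> (a + j) < j" using j by simp
      moreover have "part \<beta> (a + j) \<le> p" using False by simp
      ultimately have "P j $ j = 0"
        unfolding P_def by (subst lin_geom_ge) (simp_all add: prod_lin_nth_eq_0)
      moreover have "{p + 1..part \<beta> (a + j)} = {}" using False by simp
      ultimately show ?thesis using j by (simp add: complete_sym_conventions(3))
    qed
  qed
  have e: "(-1) ^ (m - j) * elementary_sym (int (m - j)) {r + 1..part \<beta> (a + j + 1)} =
      Q (Suc j) $ (m - j)" if "j \<le> m" for j
  proof (cases "j = m")
    case True
    then show ?thesis
      by (simp add: Q_def lin_geom_nth_0 elementary_sym_conventions del: fps_mult_nth_0)
  next
    case False
    \<comment> \<open>For \<open>j < m\<close> the index \<open>a + j + 1\<close> is at most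
      \<open>b\<close>, so monotonicity applies. For \<open>j = m\<close> it is
      \<open>b + 1\<close>, where \<beta> may lie below \<open>r\<close>, but there the degree is
      0.\<close>
    have "r \<le> part \<beta> b" using le assms by (auto simp: r_def)
    also have "\<dots> \<le> part \<beta> (a + j + 1)"
      using that False m assms by (intro part_mono[OF \<beta>]) auto
    finally have "r \<le> part \<beta> (a + Suc j)" by simp
    then show ?thesis
      unfolding Q_def by (subst lin_geom_ge) (simp_all add: elementary_sym_nth)
  qed
  have step: "\<exists>y. P (Suc j) = (1 - fps_const y * fps_X) * P j \<and>
      Q j = (1 - fps_const y * fps_X) * Q (Suc j)" if "1 \<le> j" "j < m" for j
  proof -
    let ?q = "part \<beta> (a + Suc j)"
    have "a + j \<in> {1..<n}" using that m assms by auto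
    then have "int ?q \<ge> int (part \<beta> (a + j)) - 1" using d\<beta> by fastforce
    moreover have "?q \<le> part \<beta> (a + j)"
      using that m assms by (intro part_mono[OF \<beta>]) auto
    \<comment> \<open>Consecutive parts agree, and \<open>y = 0\<close> works, or they differ by
      one, and \<open>y\<close> is the indeterminate with index \<open>Suc ?q\<close>.\<close>
    ultimately consider "part \<beta> (a + j) = ?q" | "part \<beta> (a + j) = Suc ?q" by linarith
    then show ?thesis
    proof cases
      case 1
      then show ?thesis by (intro exI[of _ 0]) (simp add: P_def Q_def)
    next
      case 2
      have "P (Suc j) = lin_fps (Suc ?q) * P j"
      proof -
        have "lin_fps (Suc ?q) * P j =
            (lin_fps (Suc ?q) * geom_fps (Suc ?q)) * (prod lin_fps {1..p} * prod geom_fps {1..?q})"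
          unfolding P_def 2 by (simp add: mult_ac)
        then show ?thesis by (simp add: P_def lin_geom)
      qed
      moreover have "Q j = lin_fps (Suc ?q) * Q (Suc j)"
        unfolding Q_def 2 by (simp add: mult_ac)
      ultimately show ?thesis unfolding lin_fps_def by blast
    qed
  qed
  have "(\<Sum>j\<le>m. P j $ j * Q (Suc j) $ (m - j)) = (P 1 * Q 1) $ m"
    by (rule telescoping_conv[where P = P and Q = Q, OF m(1) step])
      (simp_all add: P_def Q_def lin_geom_nth_0 del: fps_mult_nth_0)
  also have "P 1 * Q 1 = prod lin_fps {1..p} * prod geom_fps {1..r} *
      (prod lin_fps {1..part \<beta> (a + 1)} * prod geom_fps {1..part \<beta> (a + 1)})"
    by (simp add: P_def Q_def mult_ac)
  also have "\<dots> = prod lin_fps {r + 1..p}"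
    by (simp only: prod_lin_geom lin_geom_ge[OF rp(1)] mult_1_right)
  also have "prod lin_fps {r + 1..p} $ m = 0"
    using rp by (simp add: prod_lin_nth_eq_0)
  finally have "(\<Sum>j\<le>m. P j $ j * Q (Suc j) $ (m - j)) = 0" .
  moreover have "(\<Sum>j\<le>m. complete_sym (int j) {p + 1..part \<beta> (a + j)} *
      ((-1) ^ (m - j) * elementary_sym (int (m - j)) {r + 1..part \<beta> (a + j + 1)})) =
      (\<Sum>j\<le>m. P j $ j * Q (Suc j) $ (m - j))"
    by (rule sum.cong[OF refl]) (simp only: h e atMost_iff)
  ultimately show ?thesis
    unfolding m_def[symmetric] p_def[symmetric] r_def[symmetric] by (simp only:)
qed

section \<open>Application of Jacobi's identity and cancellation of signs\<close>

theorem theorem1p3: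
  fixes n :: nat
    and A B :: "nat set"
    and \<alpha> \<beta> :: "nat list"
  assumes "A \<subseteq> {0..n}" and "B \<subseteq> {0..n}" and "card A = card B"
    and "is_partition n \<alpha>" and "is_partition n \<beta>"
    and "\<forall>i\<in>{1..n}. part \<alpha> i \<le> part \<beta> i"
    and "\<forall>i\<in>{1..<n}. int (part \<alpha> (i + 1)) \<ge> int (part \<alpha> i) - 1"
    and "\<forall>i\<in>{1..<n}. int (part \<beta> (i + 1)) \<ge> int (part \<beta> i) - 1"
  shows
    "det (indexed_mat A B
        (\<lambda>a b. complete_sym (int b - int a) {part \<alpha> (a + 1) + 1..part \<beta> b}
           :: 'a::comm_ring_1 mvpoly)) =
     det (indexed_mat ({0..n} - A) ({0..n} - B)
        (\<lambda>a' b'. elementary_sym (int a' - int b') {part \<alpha> a' + 1..part \<beta> (b' + 1)}))"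
proof -
  define h :: "nat \<Rightarrow> nat \<Rightarrow> 'a mvpoly" where
    "h a b = complete_sym (int b - int a) {part \<alpha> (a + 1) + 1..part \<beta> b}" for a b
  define e :: "nat \<Rightarrow> nat \<Rightarrow> 'a mvpoly" where
    "e a b = elementary_sym (int a - int b) {part \<alpha> a + 1..part \<beta> (b + 1)}" for a b
  \<comment> \<open>The sign of \<open>b - c\<close> is split into a row and a column factor, the
    form that \<open>det_indexed_mat_scale\<close> can extract; the indices of \<open>e\<close> are
    swapped because the inverse is the transposed matrix.\<close>
  define g where "g c b = (-1) ^ b * (-1) ^ c * e b c" for b c
  let ?A = "{0..n} - A" and ?B = "{0..n} - B"
  have h_0: "h a b = 0" if "b < a" for a b
    using that by (simp add: h_def complete_sym_conventions)
  have g_0: "g c b = 0" if "b < c" for b c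
    using that by (simp add: g_def e_def elementary_sym_conventions)
  have h_1: "h a a = 1" and g_1: "g a a = 1" for a
    by (simp_all add: h_def g_def e_def complete_sym_conventions elementary_sym_conventions
        flip: power_add mult_2)
  have inv: "(\<Sum>c<Suc n. h a c * g c b) = (if a = b then 1 else 0)"
    if "a < Suc n" "b < Suc n" for a b
  proof -
    \<comment> \<open>Negative degrees make both matrices upper triangular, so only indices between
      \<open>a\<close> and \<open>b\<close> contribute.\<close>
    have range: "(\<Sum>c<Suc n. h a c * g c b) = (\<Sum>c\<in>{a..b}. h a c * g c b)"
      using that by (intro sum.mono_neutral_right) (auto simp: h_0 g_0 not_le)
    consider "b < a" | "a = b" | "a < b" by linarith
    then show ?thesis
    proof cases
      case 3
      have "(\<Sum>c\<in>{a..b}. h a c * g c b) = (\<Sum>j\<le>b - a. h a (a + j) * g (a + j) b)"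
        by (rule sum.reindex_bij_witness[of _ "\<lambda>j. a + j" "\<lambda>c. c - a"]) (use 3 in auto)
      also have "\<dots> = (\<Sum>j\<le>b - a. complete_sym (int j) {part \<alpha> (a + 1) + 1..part \<beta> (a + j)} *
          ((-1) ^ (b - a - j) *
            elementary_sym (int (b - a - j)) {part \<alpha> b + 1..part \<beta> (a + j + 1)}))"
      proof (rule sum.cong[OF refl])
        fix j assume "j \<in> {..b - a}"
        then obtain k where k: "b = a + j + k" "b - a - j = k"
          using 3 by (metis add.assoc atMost_iff le_add_diff_inverse less_imp_le)
        \<comment> \<open>The exponents on the left add up to
          \<open>2 * (a + j) + k\<close>.\<close>
        have "(-1) ^ b * (-1) ^ (a + j) = ((-1) ^ k :: 'a mvpoly)"
          by (simp add: k(1) minus_one_power_iff)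
        then show "h a (a + j) * g (a + j) b =
            complete_sym (int j) {part \<alpha> (a + 1) + 1..part \<beta> (a + j)} *
            ((-1) ^ (b - a - j) *
              elementary_sym (int (b - a - j)) {part \<alpha> b + 1..part \<beta> (a + j + 1)})"
          unfolding h_def g_def e_def k(2) by (simp add: k(1))
      qed
      also have "\<dots> = 0"
        using assms 3 that by (intro complete_elementary_orthogonal[of n]) auto
      finally show ?thesis using range 3 by simp
    qed (use range h_1 g_1 in auto)
  qed
  have "det (Matrix.mat (Suc n) (Suc n) (\<lambda>(a, b). h a b)) = 1"
  proof -
    have "upper_triangular (Matrix.mat (Suc n) (Suc n) (\<lambda>(a, b). h a b))"
      by (simp add: upper_triangular_def h_0)
    then have "det (Matrix.mat (Suc n) (Suc n) (\<lambda>(a, b). h a b)) =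
        prod_list (diag_mat (Matrix.mat (Suc n) (Suc n) (\<lambda>(a, b). h a b)))"
      by (rule det_upper_triangular) (rule mat_carrier)
    also have "diag_mat (Matrix.mat (Suc n) (Suc n) (\<lambda>(a, b). h a b)) = replicate (Suc n) 1"
      by (rule nth_equalityI) (simp_all add: diag_mat_def h_1 del: upt_Suc replicate_Suc)
    also have "prod_list \<dots> = 1"
      by (simp only: prod_list_replicate power_one)
    finally show ?thesis .
  qed
  moreover have "{..<Suc n} = {0..n}" by auto
  ultimately have jacobi: "det (indexed_mat A B h) =
      (-1) ^ (\<Sum>A + \<Sum>B) * det (indexed_mat ?B ?A g)"
    using jacobi_complementary_minor[of A "Suc n" B h g] assms(1-3) inv by simp
  have fin: "finite A" "finite B"
    using assms(1,2) finite_subset by blast+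
  then have card: "card ?A = card ?B"
    using assms(1-3) by (simp add: card_Diff_subset)
  have "det (indexed_mat ?B ?A g) = det (indexed_mat ?A ?B (\<lambda>a b. (-1) ^ a * (-1) ^ b * e a b))"
    unfolding g_def by (rule det_indexed_mat_transpose) (rule card[symmetric])
  also have "\<dots> = (\<Prod>a\<in>?A. (-1) ^ a) * (\<Prod>b\<in>?B. (-1) ^ b) * det (indexed_mat ?A ?B e)"
    by (rule det_indexed_mat_scale) (simp_all add: card)
  also have "(\<Prod>a\<in>?A. (-1) ^ a) * (\<Prod>b\<in>?B. (-1) ^ b) = ((-1) ^ (\<Sum>?A + \<Sum>?B) :: 'a mvpoly)"
    by (simp only: power_sum power_add)
  finally have signs: "det (indexed_mat ?B ?A g) =
      (-1) ^ (\<Sum>?A + \<Sum>?B) * det (indexed_mat ?A ?B e)" .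
  have compl: "\<Sum>C + \<Sum>({0..n} - C) = \<Sum>{0..n}" if "C \<subseteq> {0..n}" for C
    using sum.subset_diff[OF that finite_atLeastAtMost, of "\<lambda>x. x"] by (simp only: add.commute)
  \<comment> \<open>Jacobi's sign and the checkerboard signs together have this even exponent, so
    they cancel.\<close>
  have "\<Sum>A + \<Sum>B + (\<Sum>?A + \<Sum>?B) = 2 * \<Sum>{0..n}"
    using compl[OF assms(1)] compl[OF assms(2)] by linarith
  then have "(-1) ^ (\<Sum>A + \<Sum>B) * (-1) ^ (\<Sum>?A + \<Sum>?B) = (1 :: 'a mvpoly)"
    by (simp only: power_add[symmetric] power_minus1_even)
  then have "det (indexed_mat A B h) = det (indexed_mat ?A ?B e)"
    by (simp only: jacobi signs mult.assoc[symmetric] mult_1_left)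
  then show ?thesis
    unfolding h_def e_def .
qed

end
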